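(* For $t>0$ let $\Theta(t)=\{\theta\in\mathrm{Sym}^+(2,\mathbb{R}):|\theta|=t\}$, so that $\mathrm{Sym}^+(2,\mathbb{R})=\bigcup_{t>0}\Theta(t)$. Let $f:(0,\infty)\to\mathbb{R}$ be convex with $f(1)=0$. Then for every $t>0$, the $f$-divergence between Poincaré distributions is symmetric on $\Theta(t)$: $$D_f[p_{\theta_1}:p_{\theta_2}]=D_f[p_{\theta_2}:p_{\theta_1}]\quad\text{for all }\theta_1,\theta_2\in\Theta(t).$$
   Context: $\mathbb{H}=\{(x,y)\in\mathbb{R}^2: y>0\}$. $\mathrm{Sym}^+(2,\mathbb{R})$ is the set of real symmetric positive-definite $2\times2$ matrices; $|\theta|$ denotes the determinant of $\theta$. For $\theta=\begin{bmatrix} a & b \\ b & c \end{bmatrix}\in\mathrm{Sym}^+(2,\mathbb{R})$, the Poincaré distribution $p_\theta$ is the probability distribution on $\mathbb{H}$ with density (with respect to $dx\,dy$) $$p_\theta(x,y)=\frac{\sqrt{|\theta|}\,e^{2\sqrt{|\theta|}}}{\pi}\exp\left(-\frac{a(x^2+y^2)+2bx+c}{y}\right)\frac1{y^2}.$$ The $f$-divergence between densities $p,q$ on $\mathbb{H}$ is $D_f[p:q]=\int_{\mathbb{H}}p\,f(q/p)\,dx\,dy\in[0,+\infty]$. *)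

theory Defs
  imports "HOL-Analysis.Analysis"
begin

definition upper_half_plane :: "(real \<times> real) set" where
  "upper_half_plane = {(x, y). y > 0}"

definition sym_pos_def :: "(real^2^2) set" where
  "sym_pos_def = {A. transpose A = A \<and> (\<forall>v. v \<noteq> 0 \<longrightarrow> v \<bullet> (A *v v) > 0)}"

definition Theta :: "real \<Rightarrow> (real^2^2) set" where
  "Theta t = {\<theta> \<in> sym_pos_def. det \<theta> = t}"

definition poincare_density :: "real^2^2 \<Rightarrow> real \<times> real \<Rightarrow> real" where
  "poincare_density \<theta> = (\<lambda>(x, y).
     sqrt (det \<theta>) * exp (2 * sqrt (det \<theta>)) / pi
     * exp (- ((\<theta>$1$1 * (x\<^sup>2 + y\<^sup>2) + 2 * \<theta>$1$2 * x + \<theta>$2$2) / y))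
     * (1 / y\<^sup>2))"

text \<open>
  The integral of \<open>p f(q/p)\<close> over the half-plane as an extended real: the integral of the
  positive part minus the integral of the negative part (\<open>ennreal\<close> sends negative reals
  to 0).  For convex \<open>f\<close> and probability densities \<open>p, q > 0\<close>, an affine minorant of
  \<open>f\<close> at 1 shows that the second term is finite, so the difference is never of the form
  infinity minus infinity, and the value may be plus infinity.
\<close>
definition f_divergence ::
    "(real \<Rightarrow> real) \<Rightarrow> (real \<times> real \<Rightarrow> real) \<Rightarrow> (real \<times> real \<Rightarrow> real) \<Rightarrow> ereal" where
  "f_divergence f p q =
     enn2ereal (\<integral>\<^sup>+ z\<in>upper_half_plane. ennreal (p z * f (q z / p z)) \<partial>lborel)
     - enn2ereal (\<integral>\<^sup>+ z\<in>upper_half_plane. ennreal (- (p z * f (q z / p z))) \<partial>lborel)"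

end

theory Submission
  imports Defs
begin

text \<open>
  With respect to the hyperbolic measure \<open>dx dy / y\<^sup>2\<close>, the density of the Poincare
  distribution of \<open>\<theta>\<close> is a constant depending only on \<open>det \<theta>\<close> times \<open>exp (- E)\<close>, where the
  energy \<open>E\<close> is \<open>2 * sqrt (det \<theta>)\<close> times the hyperbolic cosine of the distance to a point
  determined by \<open>\<theta>\<close>. The hyperbolic reflection in the perpendicular bisector of the two points belonging to
  \<open>\<theta>\<^sub>1, \<theta>\<^sub>2 \<in> Theta t\<close> preserves the measure and exchanges the two energies, hence exchanges the
  two arguments of the divergence. The bisector is the zero set of the difference of the two
  quadratic numerators: a vertical line if the upper left entries agree, a circle centred on the
  real axis otherwise.

  Invariance of the measure under the circle inversion becomes one-dimensional in the coordinates
  \<open>u = (x - p) / y\<close> and \<open>y\<close>: the measure is \<open>du dy / y\<close>, and the inversion fixes \<open>u\<close> and maps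
  \<open>y\<close> to \<open>k / y\<close> with \<open>k = R / (1 + u\<^sup>2)\<close>.
\<close>

section \<open>The substitution \<open>y\<close> to \<open>k / y\<close> on the positive
  half-line\<close>

text \<open>The substitution rule for compact intervals requires a nonnegative derivative, so the
  increasing map \<open>- k / y\<close> is applied to \<open>h (- y)\<close>. Exhausting the
  half-lines by compact intervals then gives the improper version.\<close>

lemma nn_integral_reciprocal_substitution:
  fixes h :: "real \<Rightarrow> ennreal"
  assumes [measurable]: "h \<in> borel_measurable borel" and k: "k > 0"
  shows "(\<integral>\<^sup>+y. h y * indicator {0<..} y \<partial>lborel)
       = (\<integral>\<^sup>+y. h (k / y) * ennreal (k / y\<^sup>2) * indicator {0<..} y \<partial>lborel)"
proof -
  \<comment> \<open>\<open>J n\<close> is the image of \<open>I n\<close> under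
    \<open>- k / y\<close>; the shift by 2 makes \<open>I n\<close> nondegenerate already for
    \<open>n = 0\<close>.\<close>
  define I where "I n = {1 / (real n + 2)..real n + 2}" for n
  define J where "J n = {- k * (real n + 2)..- k / (real n + 2)}" for n
  \<comment> \<open>Read as measures of \<open>J n\<close> and \<open>I n\<close>, the integrals
    pass to the limit by continuity from below.\<close>
  define \<mu> where "\<mu> = density lborel (\<lambda>y. h (- y))"
  define \<nu> where "\<nu> = density lborel (\<lambda>y. h (k / y) * ennreal (k / y\<^sup>2))"
  have eq: "emeasure \<mu> (J n) = emeasure \<nu> (I n)" for n
  proof -
    let ?a = "1 / (real n + 2)" and ?b = "real n + 2"
    have pos: "w > 0" if "w \<in> {?a..?b}" for w
      using that by (auto intro: less_le_trans[of 0 ?a])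
    have "?a \<le> 1" by simp
    also have "1 < ?b" by simp
    finally have "?a < ?b" .
    have "(\<integral>\<^sup>+y. h (- y) * indicator {- k / ?a..- k / ?b} y \<partial>lborel)
        = (\<integral>\<^sup>+y. h (- (- k / y)) * ennreal (k / y\<^sup>2) * indicator {?a..?b} y \<partial>lborel)"
    proof (rule nn_integral_substitution_aux[OF _ _ _ _ _ \<open>?a < ?b\<close>])
      show "((\<lambda>y. - k / y) has_real_derivative k / w\<^sup>2) (at w)" if "w \<in> {?a..?b}" for w
        using pos[OF that] by (auto intro!: derivative_eq_intros simp: power2_eq_square)
      show "continuous_on {?a..?b} (\<lambda>y. k / y\<^sup>2)"
        using pos by (intro continuous_intros) force
    qed (use k in auto)
    then show ?thesis
      by (simp add: \<mu>_def \<nu>_def I_def J_def emeasure_density)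
  qed
  have incI: "incseq I"
    by (auto simp: I_def incseq_def frac_le)
  have incJ: "incseq J"
    using k by (auto simp: J_def incseq_def frac_le intro: order_trans)
  have unI: "(\<Union>n. I n) = {0<..}"
  proof (intro equalityI subsetI)
    fix y :: real assume "y \<in> {0<..}"
    moreover obtain n where "max y (1 / y) \<le> real n"
      using real_arch_simple by blast
    ultimately show "y \<in> (\<Union>n. I n)"
      by (intro UN_I[of n]) (auto simp: I_def field_simps)
  qed (auto simp: I_def intro: less_le_trans[of 0 "1 / (real _ + 2)"])
  have unJ: "(\<Union>n. J n) = {..<0}"
  proof (intro equalityI subsetI)
    fix y :: real assume "y \<in> {..<0}"
    moreover obtain n where "max (- y / k) (- k / y) \<le> real n"
      using real_arch_simple by blast
    ultimately show "y \<in> (\<Union>n. J n)"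
      using k by (intro UN_I[of n]) (auto simp: J_def field_simps)
  next
    fix y assume "y \<in> (\<Union>n. J n)"
    then obtain n where "y \<le> - k / (real n + 2)" by (auto simp: J_def)
    also have "\<dots> < 0" using k by (simp add: divide_neg_pos)
    finally show "y \<in> {..<0}" by simp
  qed
  have "(\<integral>\<^sup>+y. h y * indicator {0<..} y \<partial>lborel) = (\<integral>\<^sup>+y. h (- y) * indicator {..<0} y \<partial>lborel)"
    by (subst nn_integral_real_affine[where c = "-1" and t = 0])
       (auto intro!: nn_integral_cong split: split_indicator)
  also have "\<dots> = emeasure \<mu> (\<Union>n. J n)"
    unfolding unJ by (simp add: \<mu>_def emeasure_density)
  also have "\<dots> = (SUP n. emeasure \<mu> (J n))"
    by (intro SUP_emeasure_incseq[symmetric] incJ) (auto simp: \<mu>_def J_def)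
  also have "\<dots> = (SUP n. emeasure \<nu> (I n))"
    by (simp add: eq)
  also have "\<dots> = emeasure \<nu> (\<Union>n. I n)"
    by (intro SUP_emeasure_incseq incI) (auto simp: \<nu>_def I_def)
  also have "\<dots> = (\<integral>\<^sup>+y. h (k / y) * ennreal (k / y\<^sup>2) * indicator {0<..} y \<partial>lborel)"
    unfolding unI by (simp add: \<nu>_def emeasure_density)
  finally show ?thesis .
qed


section \<open>The hyperbolic measure and its slope coordinates\<close>

text \<open>Hyperbolic area extended by zero to the whole plane, so that measurability is plain
  Borel measurability.\<close>

definition hyperbolic_measure :: "(real \<times> real) measure" where
  "hyperbolic_measure =
     density lborel (\<lambda>z. ennreal (1 / (snd z)\<^sup>2) * indicator {0<..} (snd z))"

lemma borel_measurable_fst_real [measurable]: "fst \<in> borel_measurable (borel :: (real \<times> real) measure)"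
  and borel_measurable_snd_real [measurable]: "snd \<in> borel_measurable (borel :: (real \<times> real) measure)"
  by (simp_all add: borel_prod[symmetric])

lemma nn_integral_hyperbolic_measure:
  assumes "h \<in> borel_measurable borel"
  shows "(\<integral>\<^sup>+z. h z \<partial>hyperbolic_measure)
    = (\<integral>\<^sup>+z. h z * (ennreal (1 / (snd z)\<^sup>2) * indicator {0<..} (snd z)) \<partial>lborel)"
  using assms unfolding hyperbolic_measure_def
  by (subst nn_integral_density) (auto simp: mult.commute)

lemma nn_integral_hyperbolic_measure_cong:
  assumes "\<And>x y. y > 0 \<Longrightarrow> g (x, y) = h (x, y)"
    and "g \<in> borel_measurable borel" "h \<in> borel_measurable borel"
  shows "(\<integral>\<^sup>+z. g z \<partial>hyperbolic_measure) = (\<integral>\<^sup>+z. h z \<partial>hyperbolic_measure)"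
proof -
  have "g z * (ennreal (1 / (snd z)\<^sup>2) * indicator {0<..} (snd z))
    = h z * (ennreal (1 / (snd z)\<^sup>2) * indicator {0<..} (snd z))" for z
    by (cases z; cases "snd z > 0") (simp_all add: assms(1))
  then show ?thesis
    using assms(2,3) by (simp add: nn_integral_hyperbolic_measure)
qed

text \<open>At fixed \<open>y > 0\<close> the substitution \<open>x = p + u * y\<close> has Jacobian
  \<open>y\<close>, which turns the weight \<open>1 / y\<^sup>2\<close> into \<open>1 / y\<close>.
  Exchanging the integrals puts \<open>y\<close> inside, where an inversion centred at
  \<open>p\<close> acts with \<open>u\<close> fixed.\<close>

lemma nn_integral_hyperbolic_slope:
  assumes [measurable]: "h \<in> borel_measurable borel"
  shows "(\<integral>\<^sup>+z. h z \<partial>hyperbolic_measure)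
    = (\<integral>\<^sup>+u. \<integral>\<^sup>+y. h (p + u * y, y) * ennreal (1 / y) * indicator {0<..} y \<partial>lborel \<partial>lborel)"
proof -
  let ?g = "\<lambda>z. h z * (ennreal (1 / (snd z)\<^sup>2) * indicator {0<..} (snd z))"
  have h' [measurable]: "h \<in> borel_measurable (borel \<Otimes>\<^sub>M borel)"
    by (simp add: borel_prod)
  have "(\<integral>\<^sup>+z. h z \<partial>hyperbolic_measure) = (\<integral>\<^sup>+z. ?g z \<partial>(lborel \<Otimes>\<^sub>M lborel))"
    by (simp add: nn_integral_hyperbolic_measure lborel_prod)
  also have "\<dots> = (\<integral>\<^sup>+y. \<integral>\<^sup>+x. ?g (x, y) \<partial>lborel \<partial>lborel)"
    by (subst lborel_pair.nn_integral_snd) auto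
  also have "\<dots> = (\<integral>\<^sup>+y. \<integral>\<^sup>+u. h (p + u * y, y) * ennreal (1 / y) * indicator {0<..} y \<partial>lborel \<partial>lborel)"
  proof (rule nn_integral_cong)
    fix y :: real
    show "(\<integral>\<^sup>+x. ?g (x, y) \<partial>lborel)
      = (\<integral>\<^sup>+u. h (p + u * y, y) * ennreal (1 / y) * indicator {0<..} y \<partial>lborel)"
    proof (cases "y > 0")
      case True
      have w: "ennreal y * ennreal (1 / y\<^sup>2) = ennreal (1 / y)"
        using True by (simp add: ennreal_mult[symmetric] power2_eq_square)
      have eq: "ennreal y * ?g (p + y * u, y) = h (p + u * y, y) * ennreal (1 / y) * indicator {0<..} y" for u
        unfolding w[symmetric] by (simp add: mult_ac)
      have "(\<integral>\<^sup>+x. ?g (x, y) \<partial>lborel) = ennreal \<bar>y\<bar> * (\<integral>\<^sup>+u. ?g (p + y * u, y) \<partial>lborel)"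
        using True by (intro nn_integral_real_affine) auto
      also have "\<dots> = (\<integral>\<^sup>+u. ennreal y * ?g (p + y * u, y) \<partial>lborel)"
        using True by (subst nn_integral_cmult) auto
      finally show ?thesis
        unfolding eq .
    qed simp
  qed
  also have "\<dots> = (\<integral>\<^sup>+u. \<integral>\<^sup>+y. h (p + u * y, y) * ennreal (1 / y) * indicator {0<..} y \<partial>lborel \<partial>lborel)"
    by (rule lborel_pair.Fubini') auto
  finally show ?thesis .
qed

section \<open>Hyperbolic reflections and invariance of the measure\<close>

definition vertical_reflection :: "real \<Rightarrow> real \<times> real \<Rightarrow> real \<times> real" where
  "vertical_reflection m = (\<lambda>(x, y). (2 * m - x, y))"

text \<open>\<open>R\<close> is the squared radius, which avoids square roots. Division by zero
  sends the centre \<open>(p, 0)\<close> to itself, a point outside the support of the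
  weight.\<close>

definition circle_inversion :: "real \<Rightarrow> real \<Rightarrow> real \<times> real \<Rightarrow> real \<times> real" where
  "circle_inversion p R = (\<lambda>(x, y).
     (p + R * (x - p) / ((x - p)\<^sup>2 + y\<^sup>2), R * y / ((x - p)\<^sup>2 + y\<^sup>2)))"

lemma borel_measurable_vertical_reflection [measurable]:
  "vertical_reflection m \<in> borel_measurable borel"
  unfolding vertical_reflection_def split_beta by measurable

lemma borel_measurable_circle_inversion [measurable]:
  "circle_inversion p R \<in> borel_measurable borel"
  unfolding circle_inversion_def split_beta by measurable

text \<open>In slope coordinates based at \<open>m\<close> the reflection is \<open>u\<close> to
  \<open>- u\<close> with \<open>y\<close> fixed.\<close>

lemma nn_integral_hyperbolic_vertical_reflection:
  assumes [measurable]: "h \<in> borel_measurable borel"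
  shows "(\<integral>\<^sup>+z. h (vertical_reflection m z) \<partial>hyperbolic_measure) = (\<integral>\<^sup>+z. h z \<partial>hyperbolic_measure)"
proof -
  have h' [measurable]: "h \<in> borel_measurable (borel \<Otimes>\<^sub>M borel)"
    by (simp add: borel_prod)
  have "(\<integral>\<^sup>+z. h z \<partial>hyperbolic_measure)
    = (\<integral>\<^sup>+u. \<integral>\<^sup>+y. h (m + u * y, y) * ennreal (1 / y) * indicator {0<..} y \<partial>lborel \<partial>lborel)"
    by (rule nn_integral_hyperbolic_slope) simp
  also have "\<dots> = (\<integral>\<^sup>+u. \<integral>\<^sup>+y. h (m - u * y, y) * ennreal (1 / y) * indicator {0<..} y \<partial>lborel \<partial>lborel)"
    by (subst nn_integral_real_affine[where c = "-1" and t = 0]) auto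
  also have "\<dots> = (\<integral>\<^sup>+z. h (vertical_reflection m z) \<partial>hyperbolic_measure)"
    by (subst nn_integral_hyperbolic_slope[where p = m])
       (auto simp: vertical_reflection_def intro!: nn_integral_cong)
  finally show ?thesis by simp
qed

lemma nn_integral_hyperbolic_circle_inversion:
  assumes [measurable]: "h \<in> borel_measurable borel" and R: "R > 0"
  shows "(\<integral>\<^sup>+z. h (circle_inversion p R z) \<partial>hyperbolic_measure) = (\<integral>\<^sup>+z. h z \<partial>hyperbolic_measure)"
proof -
  have h' [measurable]: "h \<in> borel_measurable (borel \<Otimes>\<^sub>M borel)"
    by (simp add: borel_prod)
  have inner: "(\<integral>\<^sup>+y. h (p + u * y, y) * ennreal (1 / y) * indicator {0<..} y \<partial>lborel)
    = (\<integral>\<^sup>+y. h (circle_inversion p R (p + u * y, y)) * ennreal (1 / y) * indicator {0<..} y \<partial>lborel)" for u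
  proof -
    \<comment> \<open>The point of slope \<open>u\<close> and height \<open>y\<close> has squared
      distance \<open>y\<^sup>2 * (1 + u\<^sup>2)\<close> from the centre, so the inversion gives it
      height \<open>k / y\<close>.\<close>
    define k where "k = R / (1 + u\<^sup>2)"
    have u: "1 + u\<^sup>2 > 0" by (simp add: add_pos_nonneg)
    have k: "k > 0" using R u by (simp add: k_def)
    have "(\<integral>\<^sup>+y. h (p + u * y, y) * ennreal (1 / y) * indicator {0<..} y \<partial>lborel)
      = (\<integral>\<^sup>+y. h (p + u * (k / y), k / y) * ennreal (1 / (k / y)) * ennreal (k / y\<^sup>2) * indicator {0<..} y \<partial>lborel)"
      using k by (intro nn_integral_reciprocal_substitution) auto
    also have "\<dots> = (\<integral>\<^sup>+y. h (circle_inversion p R (p + u * y, y)) * ennreal (1 / y) * indicator {0<..} y \<partial>lborel)"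
    proof (intro nn_integral_cong)
      fix y :: real
      show "h (p + u * (k / y), k / y) * ennreal (1 / (k / y)) * ennreal (k / y\<^sup>2) * indicator {0<..} y
        = h (circle_inversion p R (p + u * y, y)) * ennreal (1 / y) * indicator {0<..} y"
      proof (cases "y > 0")
        case True
        have "R * y / ((u * y)\<^sup>2 + y\<^sup>2) = R * y / (y * (y * (1 + u\<^sup>2)))"
          by (simp add: power2_eq_square algebra_simps)
        also have "\<dots> = k / y"
          using True by (simp add: k_def mult.commute)
        finally have y': "R * y / ((u * y)\<^sup>2 + y\<^sup>2) = k / y" .
        have "R * (u * y) / ((u * y)\<^sup>2 + y\<^sup>2) = u * (R * y / ((u * y)\<^sup>2 + y\<^sup>2))"
          by simp
        then have "circle_inversion p R (p + u * y, y) = (p + u * (k / y), k / y)"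
          unfolding circle_inversion_def using y' by simp
        \<comment> \<open>This is the invariance of \<open>dy / y\<close>: the transformed weight
          times the Jacobian is the old weight.\<close>
        moreover have "ennreal (1 / (k / y)) * ennreal (k / y\<^sup>2) = ennreal (1 / y)"
          using True k by (simp add: ennreal_mult[symmetric] power2_eq_square)
        ultimately show ?thesis
          by (simp add: mult.assoc)
      qed simp
    qed
    finally show ?thesis .
  qed
  show ?thesis
    by (simp add: nn_integral_hyperbolic_slope[where p = p] inner)
qed

section \<open>Energies and the action of reflections on them\<close>

definition poincare_energy :: "real^2^2 \<Rightarrow> real \<times> real \<Rightarrow> real" where
  "poincare_energy \<theta> = (\<lambda>(x, y). (\<theta>$1$1 * (x\<^sup>2 + y\<^sup>2) + 2 * \<theta>$1$2 * x + \<theta>$2$2) / y)"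

lemma borel_measurable_poincare_energy [measurable]:
  "poincare_energy \<theta> \<in> borel_measurable borel"
  unfolding poincare_energy_def split_beta by measurable

lemma sym_pos_def_2:
  assumes "\<theta> \<in> sym_pos_def"
  shows "\<theta>$2$1 = \<theta>$1$2" "\<theta>$1$1 > 0" "det \<theta> > 0"
proof -
  have "transpose \<theta> $1$2 = \<theta>$1$2"
    using assms by (simp add: sym_pos_def_def)
  then show sym: "\<theta>$2$1 = \<theta>$1$2" by (simp add: transpose_def)
  have pos: "v \<bullet> (\<theta> *v v) > 0" if "v \<noteq> 0" for v
    using assms that by (simp add: sym_pos_def_def)
  have "(vector [1, 0] :: real^2) \<noteq> 0" by (simp add: vec_eq_iff forall_2)
  from pos[OF this] show a: "\<theta>$1$1 > 0"
    by (simp add: inner_vec_def matrix_vector_mult_def sum_2)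
  \<comment> \<open>\<open>\<theta>\<close> maps this vector to \<open>(0, det \<theta>)\<close>, so
    the quadratic form takes the value \<open>\<theta>$1$1 * det \<theta>\<close> on it.\<close>
  have "(vector [- \<theta>$1$2, \<theta>$1$1] :: real^2) \<noteq> 0" using a by (simp add: vec_eq_iff forall_2)
  from pos[OF this] have "\<theta>$1$1 * det \<theta> > 0"
    by (simp add: inner_vec_def matrix_vector_mult_def sum_2 det_2 sym algebra_simps)
  then show "det \<theta> > 0" using a by (simp add: zero_less_mult_iff)
qed


lemma Theta_entries:
  assumes "\<theta> \<in> Theta t"
  shows "\<theta>$1$1 > 0" "\<theta>$1$1 * \<theta>$2$2 - (\<theta>$1$2)\<^sup>2 = t"
  using assms sym_pos_def_2[of \<theta>]
  by (auto simp: Theta_def det_2 power2_eq_square)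

text \<open>The points belonging to the matrices have abscissae \<open>- b / a\<close> and
  \<open>- b' / a\<close> and the same height \<open>sqrt t / a\<close>; the mirror is the vertical
  line midway between them.\<close>

lemma poincare_energy_vertical_reflection:
  assumes a: "\<theta>$1$1 = \<theta>'$1$1"
    and "\<theta> \<in> Theta t" "\<theta>' \<in> Theta t"
  shows "poincare_energy \<theta> (vertical_reflection (- (\<theta>$1$2 + \<theta>'$1$2) / (2 * \<theta>$1$1)) (x, y))
    = poincare_energy \<theta>' (x, y)"
proof -
  define a b c b' c' where "a = \<theta>$1$1" and "b = \<theta>$1$2" and "c = \<theta>$2$2"
    and "b' = \<theta>'$1$2" and "c' = \<theta>'$2$2"
  note defs = a_def b_def c_def b'_def c'_def
  define m where "m = - (b + b') / (2 * a)"
  have "a > 0" "a * c - b\<^sup>2 = t" "a * c' - b'\<^sup>2 = t"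
    using Theta_entries[OF assms(2)] Theta_entries[OF assms(3)] a by (simp_all add: defs)
  have m: "2 * a * m = - (b + b')"
    using \<open>a > 0\<close> by (simp add: m_def)
  \<comment> \<open>The choice of \<open>m\<close> matches the linear terms; the constant terms
    match because the determinants agree.\<close>
  have "a * (2 * m * (b - b')) = (2 * a * m) * (b - b')"
    by simp
  also have "\<dots> = b'\<^sup>2 - b\<^sup>2"
    unfolding m by (simp add: power2_eq_square algebra_simps)
  also have "\<dots> = a * (c' - c)"
    using \<open>a * c - b\<^sup>2 = t\<close> \<open>a * c' - b'\<^sup>2 = t\<close> by (simp add: algebra_simps)
  finally have c: "2 * m * (b - b') = c' - c"
    using \<open>a > 0\<close> by simp
  have "a * ((2 * m - x)\<^sup>2 + y\<^sup>2) + 2 * b * (2 * m - x) + c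
    = a * (x\<^sup>2 + y\<^sup>2) + (2 * a * m) * (2 * m - 2 * x) + 2 * b * (2 * m - x) + c"
    by (simp add: power2_eq_square algebra_simps)
  also have "\<dots> = a * (x\<^sup>2 + y\<^sup>2) + 2 * b' * x + 2 * m * (b - b') + c"
    unfolding m by (simp add: algebra_simps)
  also have "\<dots> = a * (x\<^sup>2 + y\<^sup>2) + 2 * b' * x + c'"
    unfolding c by simp
  finally show ?thesis
    using a by (simp add: poincare_energy_def vertical_reflection_def defs m_def)
qed

text \<open>
  The assumptions say that the numerators of the two energies have, in terms of \<open>X = x - p\<close>, the
  form \<open>a (X\<^sup>2 + y\<^sup>2) + B X + a' R\<close> and \<open>a' (X\<^sup>2 + y\<^sup>2) + B X + a R\<close> with a common \<open>B\<close>.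
\<close>
lemma poincare_energy_circle_inversion:
  assumes "y > 0" "R > 0"
    and centre: "(\<theta>$1$1 - \<theta>'$1$1) * p = \<theta>'$1$2 - \<theta>$1$2"
    and power: "\<theta>$1$1 * p\<^sup>2 + 2 * \<theta>$1$2 * p + \<theta>$2$2 = \<theta>'$1$1 * R"
      "\<theta>'$1$1 * p\<^sup>2 + 2 * \<theta>'$1$2 * p + \<theta>'$2$2 = \<theta>$1$1 * R"
  shows "poincare_energy \<theta> (circle_inversion p R (x, y)) = poincare_energy \<theta>' (x, y)"
proof -
  define a b c a' b' c' where "a = \<theta>$1$1" and "b = \<theta>$1$2" and "c = \<theta>$2$2"
    and "a' = \<theta>'$1$1" and "b' = \<theta>'$1$2" and "c' = \<theta>'$2$2"
  note defs = a_def b_def c_def a'_def b'_def c'_def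
  define X s where "X = x - p" and "s = X\<^sup>2 + y\<^sup>2"
  \<comment> \<open>The inversion scales the vector from the centre by \<open>q\<close>. The
    numerator becomes \<open>q\<close> times that of \<open>\<theta>'\<close>, and this
    \<open>q\<close> cancels against the new height \<open>q * y\<close>.\<close>
  define q where "q = R / s"
  have "s > 0" using \<open>y > 0\<close> by (simp add: s_def add_nonneg_pos)
  then have "q > 0" "q * s = R" using \<open>R > 0\<close> by (simp_all add: q_def)
  have slope: "b + a * p = b' + a' * p"
    using centre by (simp add: defs algebra_simps)
  have "a * ((p + q * X)\<^sup>2 + (q * y)\<^sup>2) + 2 * b * (p + q * X) + c
    = a * q * (q * s) + 2 * q * (b + a * p) * X + (a * p\<^sup>2 + 2 * b * p + c)"
    by (simp add: s_def power2_eq_square algebra_simps)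
  also have "\<dots> = a * q * R + 2 * q * (b' + a' * p) * X + a' * (q * s)"
    using power(1) unfolding \<open>q * s = R\<close> slope by (simp add: defs)
  also have "\<dots> = q * (a * R + 2 * (b' + a' * p) * X + a' * s)"
    by (simp add: algebra_simps)
  also have "a * R = a' * p\<^sup>2 + 2 * b' * p + c'"
    using power(2) by (simp add: defs)
  also have "a' * p\<^sup>2 + 2 * b' * p + c' + 2 * (b' + a' * p) * X + a' * s
    = a' * (x\<^sup>2 + y\<^sup>2) + 2 * b' * x + c'"
    by (simp add: s_def X_def power2_eq_square algebra_simps)
  finally have "poincare_energy \<theta> (p + q * X, q * y) = poincare_energy \<theta>' (x, y)"
    using \<open>q > 0\<close> by (simp add: poincare_energy_def defs)
  moreover have "circle_inversion p R (x, y) = (p + q * X, q * y)"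
    by (simp add: circle_inversion_def q_def s_def X_def)
  ultimately show ?thesis by simp
qed

section \<open>The reflection exchanging two energies\<close>

lemma exists_hyperbolic_reflection_swapping:
  assumes "t > 0" "\<theta>\<^sub>1 \<in> Theta t" "\<theta>\<^sub>2 \<in> Theta t"
  obtains T where "T \<in> borel_measurable borel"
    and "\<And>h. h \<in> borel_measurable borel \<Longrightarrow>
      (\<integral>\<^sup>+z. h (T z) \<partial>hyperbolic_measure) = (\<integral>\<^sup>+z. h z \<partial>hyperbolic_measure)"
    and "\<And>x y. y > 0 \<Longrightarrow> poincare_energy \<theta>\<^sub>1 (T (x, y)) = poincare_energy \<theta>\<^sub>2 (x, y)"
    and "\<And>x y. y > 0 \<Longrightarrow> poincare_energy \<theta>\<^sub>2 (T (x, y)) = poincare_energy \<theta>\<^sub>1 (x, y)"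
proof (cases "\<theta>\<^sub>1$1$1 = \<theta>\<^sub>2$1$1")
  case True
  let ?T = "vertical_reflection (- (\<theta>\<^sub>1$1$2 + \<theta>\<^sub>2$1$2) / (2 * \<theta>\<^sub>1$1$1))"
  show ?thesis
  proof (rule that[of ?T])
    show "poincare_energy \<theta>\<^sub>1 (?T (x, y)) = poincare_energy \<theta>\<^sub>2 (x, y)" for x y
      using poincare_energy_vertical_reflection[OF True assms(2,3)] .
    \<comment> \<open>The mirror is symmetric in the two matrices, since their upper left entries
      agree.\<close>
    show "poincare_energy \<theta>\<^sub>2 (?T (x, y)) = poincare_energy \<theta>\<^sub>1 (x, y)" for x y
      using poincare_energy_vertical_reflection[OF True[symmetric] assms(3,2)] True
      by (simp add: add.commute)
  qed (simp_all add: nn_integral_hyperbolic_vertical_reflection)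
next
  case False
  define a b c a' b' c' where "a = \<theta>\<^sub>1$1$1" and "b = \<theta>\<^sub>1$1$2" and "c = \<theta>\<^sub>1$2$2"
    and "a' = \<theta>\<^sub>2$1$1" and "b' = \<theta>\<^sub>2$1$2" and "c' = \<theta>\<^sub>2$2$2"
  note defs = a_def b_def c_def a'_def b'_def c'_def
  have pos: "a > 0" "a' > 0" and det: "a * c - b\<^sup>2 = t" "a' * c' - b'\<^sup>2 = t"
    using Theta_entries[OF assms(2)] Theta_entries[OF assms(3)] by (simp_all add: defs)
  define d where "d = a - a'"
  have "d \<noteq> 0" using False by (simp add: d_def defs)
  \<comment> \<open>Completing the square: the difference of the numerators divided by
    \<open>d\<close> is \<open>(x - p)\<^sup>2 + y\<^sup>2 - R\<close>.\<close>
  define p R where "p = (b' - b) / d" and "R = p\<^sup>2 - (c - c') / d"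
  have dp: "d * p = b' - b" using \<open>d \<noteq> 0\<close> by (simp add: p_def)
  have dR: "d\<^sup>2 * R = (b' - b)\<^sup>2 - (c - c') * d"
  proof -
    have "d\<^sup>2 * ((c - c') / d) = (c - c') * d"
      using \<open>d \<noteq> 0\<close> by (simp add: power2_eq_square)
    then show ?thesis
      unfolding R_def right_diff_distrib by (simp add: power_mult_distrib[symmetric] dp)
  qed
  have ac: "a * c = t + b\<^sup>2" "a' * c' = t + b'\<^sup>2"
    using det by simp_all
  \<comment> \<open>Positivity of \<open>R\<close>: eliminating \<open>c\<close> and
    \<open>c'\<close> through the common determinant leaves \<open>t * d\<^sup>2\<close> plus a
    square.\<close>
  have "a * a' * (d\<^sup>2 * R) = a * a' * (b' - b)\<^sup>2 - (a' * (a * c) - a * (a' * c')) * d"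
    unfolding dR by (simp add: algebra_simps)
  also have "\<dots> = a * a' * (b' - b)\<^sup>2 - (a' * (t + b\<^sup>2) - a * (t + b'\<^sup>2)) * d"
    unfolding ac ..
  also have "\<dots> = t * d\<^sup>2 + (a * b' - a' * b)\<^sup>2"
    unfolding d_def by algebra
  also have "\<dots> > 0"
    using \<open>t > 0\<close> \<open>d \<noteq> 0\<close> by (simp add: add_pos_nonneg)
  finally have "0 < a * a' * (d\<^sup>2 * R)" .
  moreover have "0 < a * a'" using pos by simp
  ultimately have "0 < d\<^sup>2 * R" by (rule zero_less_mult_pos)
  moreover have "0 < d\<^sup>2" using \<open>d \<noteq> 0\<close> by simp
  ultimately have "R > 0" by (rule zero_less_mult_pos)
  \<comment> \<open>Multiplying by \<open>d\<^sup>2\<close> clears the denominators of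
    \<open>p\<close> and \<open>R\<close>; the two sides then differ by \<open>d\<close> times the
    difference of the determinants, which is zero.\<close>
  have "d\<^sup>2 * (a * p\<^sup>2 + 2 * b * p + c) = a * (d * p)\<^sup>2 + 2 * b * (d * p) * d + c * d\<^sup>2"
    by (simp add: power2_eq_square algebra_simps)
  also have "\<dots> = a' * (d\<^sup>2 * R) + d * ((a * c - b\<^sup>2) - (a' * c' - b'\<^sup>2))"
    unfolding dR dp by (simp add: d_def power2_eq_square algebra_simps)
  finally have "d\<^sup>2 * (a * p\<^sup>2 + 2 * b * p + c) = d\<^sup>2 * (a' * R)"
    unfolding det by simp
  then have power: "a * p\<^sup>2 + 2 * b * p + c = a' * R"
    using \<open>d \<noteq> 0\<close> by simp
  have "d\<^sup>2 * (a' * p\<^sup>2 + 2 * b' * p + c') = a' * (d * p)\<^sup>2 + 2 * b' * (d * p) * d + c' * d\<^sup>2"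
    by (simp add: power2_eq_square algebra_simps)
  also have "\<dots> = a * (d\<^sup>2 * R) + d * ((a * c - b\<^sup>2) - (a' * c' - b'\<^sup>2))"
    unfolding dR dp by (simp add: d_def power2_eq_square algebra_simps)
  finally have "d\<^sup>2 * (a' * p\<^sup>2 + 2 * b' * p + c') = d\<^sup>2 * (a * R)"
    unfolding det by simp
  then have power': "a' * p\<^sup>2 + 2 * b' * p + c' = a * R"
    using \<open>d \<noteq> 0\<close> by simp
  have centre: "(a - a') * p = b' - b" "(a' - a) * p = b - b'"
    using dp by (simp_all add: d_def algebra_simps)
  show ?thesis
  proof (rule that[of "circle_inversion p R"])
    fix x y :: real assume "y > 0"
    show "poincare_energy \<theta>\<^sub>1 (circle_inversion p R (x, y)) = poincare_energy \<theta>\<^sub>2 (x, y)"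
      using \<open>y > 0\<close> \<open>R > 0\<close> centre(1) power power' unfolding defs
      by (rule poincare_energy_circle_inversion)
    show "poincare_energy \<theta>\<^sub>2 (circle_inversion p R (x, y)) = poincare_energy \<theta>\<^sub>1 (x, y)"
      using \<open>y > 0\<close> \<open>R > 0\<close> centre(2) power' power unfolding defs
      by (rule poincare_energy_circle_inversion)
  qed (simp_all add: nn_integral_hyperbolic_circle_inversion \<open>R > 0\<close>)
qed

text \<open>A general \<open>F\<close> covers both the positive and the negative part of the
  divergence integrand.\<close>

lemma nn_integral_hyperbolic_swap:
  fixes F :: "real \<Rightarrow> real \<Rightarrow> ennreal"
  assumes "t > 0" "\<theta>\<^sub>1 \<in> Theta t" "\<theta>\<^sub>2 \<in> Theta t"
    and F [measurable]: "case_prod F \<in> borel_measurable (borel \<Otimes>\<^sub>M borel)"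
  shows "(\<integral>\<^sup>+z. F (poincare_energy \<theta>\<^sub>1 z) (poincare_energy \<theta>\<^sub>2 z) \<partial>hyperbolic_measure)
       = (\<integral>\<^sup>+z. F (poincare_energy \<theta>\<^sub>2 z) (poincare_energy \<theta>\<^sub>1 z) \<partial>hyperbolic_measure)"
proof -
  obtain T where T [measurable]: "T \<in> borel_measurable borel"
    and inv: "\<And>h. h \<in> borel_measurable borel \<Longrightarrow>
      (\<integral>\<^sup>+z. h (T z) \<partial>hyperbolic_measure) = (\<integral>\<^sup>+z. h z \<partial>hyperbolic_measure)"
    and swap: "\<And>x y. y > 0 \<Longrightarrow> poincare_energy \<theta>\<^sub>1 (T (x, y)) = poincare_energy \<theta>\<^sub>2 (x, y)"
      "\<And>x y. y > 0 \<Longrightarrow> poincare_energy \<theta>\<^sub>2 (T (x, y)) = poincare_energy \<theta>\<^sub>1 (x, y)"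
    using exists_hyperbolic_reflection_swapping[OF assms(1-3)] by metis
  have "(\<integral>\<^sup>+z. F (poincare_energy \<theta>\<^sub>1 z) (poincare_energy \<theta>\<^sub>2 z) \<partial>hyperbolic_measure)
      = (\<integral>\<^sup>+z. F (poincare_energy \<theta>\<^sub>1 (T z)) (poincare_energy \<theta>\<^sub>2 (T z)) \<partial>hyperbolic_measure)"
    by (rule inv[symmetric]) measurable
  also have "\<dots> = (\<integral>\<^sup>+z. F (poincare_energy \<theta>\<^sub>2 z) (poincare_energy \<theta>\<^sub>1 z) \<partial>hyperbolic_measure)"
    by (rule nn_integral_hyperbolic_measure_cong) (simp add: swap, measurable)
  finally show ?thesis .
qed

section \<open>The divergence as an integral over the two energies\<close>

text \<open>This is \<open>p f(q/p)\<close> relative to the hyperbolic measure, with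
  \<open>u\<close> and \<open>v\<close> the energies of \<open>p\<close> and
  \<open>q\<close>.\<close>

definition divergence_integrand :: "(real \<Rightarrow> real) \<Rightarrow> real \<Rightarrow> real \<Rightarrow> real \<Rightarrow> real" where
  "divergence_integrand f t u v =
     sqrt t * exp (2 * sqrt t) / pi * exp (- u) * f (exp (u - v))"

text \<open>Convexity on an open interval gives continuity there. Composition with
  \<open>exp\<close> keeps the argument of \<open>f\<close> in \<open>{0<..}\<close>, outside which
  nothing is known about \<open>f\<close>.\<close>

lemma borel_measurable_divergence_integrand:
  assumes "convex_on {0<..} f"
  shows "(\<lambda>(u, v). divergence_integrand f t u v) \<in> borel_measurable (borel \<Otimes>\<^sub>M borel)"
proof -
  have "continuous_on {0<..} f"
    using assms by (intro convex_on_continuous) auto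
  then have "continuous_on UNIV (\<lambda>w. f (exp w))"
    by (rule continuous_on_compose2) (auto intro!: continuous_intros)
  then have [measurable]: "(\<lambda>w. f (exp w)) \<in> borel_measurable borel"
    by (rule borel_measurable_continuous_onI)
  show ?thesis
    unfolding divergence_integrand_def split_beta by measurable
qed

text \<open>With equal determinants the normalising constants and the factors
  \<open>1 / y\<^sup>2\<close> cancel in the ratio, leaving only the energies.\<close>

lemma poincare_density_f_ratio:
  assumes "t > 0" "\<theta>\<^sub>1 \<in> Theta t" "\<theta>\<^sub>2 \<in> Theta t" and "y > 0"
  shows "poincare_density \<theta>\<^sub>1 (x, y) * f (poincare_density \<theta>\<^sub>2 (x, y) / poincare_density \<theta>\<^sub>1 (x, y))
    = divergence_integrand f t (poincare_energy \<theta>\<^sub>1 (x, y)) (poincare_energy \<theta>\<^sub>2 (x, y)) * (1 / y\<^sup>2)"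
proof -
  have density: "poincare_density \<theta> (x, y)
      = sqrt t * exp (2 * sqrt t) / pi * exp (- poincare_energy \<theta> (x, y)) * (1 / y\<^sup>2)"
    if "\<theta> \<in> Theta t" for \<theta>
    using that by (simp add: poincare_density_def poincare_energy_def Theta_def)
  have "poincare_density \<theta>\<^sub>2 (x, y) / poincare_density \<theta>\<^sub>1 (x, y)
      = exp (poincare_energy \<theta>\<^sub>1 (x, y) - poincare_energy \<theta>\<^sub>2 (x, y))"
    unfolding density[OF assms(2)] density[OF assms(3)]
    using \<open>t > 0\<close> \<open>y > 0\<close> by (simp add: exp_diff exp_minus field_simps)
  then show ?thesis
    by (simp add: density[OF assms(2)] divergence_integrand_def)
qed

lemma f_divergence_poincare:
  assumes "convex_on {0<..} f" "t > 0" "\<theta>\<^sub>1 \<in> Theta t" "\<theta>\<^sub>2 \<in> Theta t"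
  shows "f_divergence f (poincare_density \<theta>\<^sub>1) (poincare_density \<theta>\<^sub>2)
    = enn2ereal (\<integral>\<^sup>+z. ennreal (divergence_integrand f t
        (poincare_energy \<theta>\<^sub>1 z) (poincare_energy \<theta>\<^sub>2 z)) \<partial>hyperbolic_measure)
    - enn2ereal (\<integral>\<^sup>+z. ennreal (- divergence_integrand f t
        (poincare_energy \<theta>\<^sub>1 z) (poincare_energy \<theta>\<^sub>2 z)) \<partial>hyperbolic_measure)"
proof -
  let ?D = "\<lambda>z. divergence_integrand f t (poincare_energy \<theta>\<^sub>1 z) (poincare_energy \<theta>\<^sub>2 z)"
  let ?G = "\<lambda>z. poincare_density \<theta>\<^sub>1 z * f (poincare_density \<theta>\<^sub>2 z / poincare_density \<theta>\<^sub>1 z)"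
  note [measurable] = borel_measurable_divergence_integrand[OF assms(1)]
  have [measurable]: "?D \<in> borel_measurable borel" by measurable
  \<comment> \<open>The factor \<open>k\<close> treats both parts at once: it is taken to be 1 for
    the positive and -1 for the negative part.\<close>
  have weighted: "(\<integral>\<^sup>+z\<in>upper_half_plane. ennreal (k * ?G z) \<partial>lborel)
      = (\<integral>\<^sup>+z. ennreal (k * ?D z) \<partial>hyperbolic_measure)" for k
  proof -
    have "ennreal (k * ?G z) * indicator upper_half_plane z
        = ennreal (k * ?D z) * (ennreal (1 / (snd z)\<^sup>2) * indicator {0<..} (snd z))" for z
    proof (cases z)
      case (Pair x y)
      show ?thesis
      proof (cases "y > 0")
        case True
        have "ennreal (k * ?G z) = ennreal (k * ?D z * (1 / y\<^sup>2))"
          using True poincare_density_f_ratio[OF assms(2-4)] by (simp add: Pair)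
        also have "\<dots> = ennreal (k * ?D z) * ennreal (1 / y\<^sup>2)"
          \<comment> \<open>The factor split off is the nonnegative weight; if
            \<open>k * ?D z\<close> is negative, both sides are 0.\<close>
          by (rule ennreal_mult'') simp
        finally show ?thesis
          using True by (simp add: Pair upper_half_plane_def)
      qed (simp add: Pair upper_half_plane_def)
    qed
    then show ?thesis
      by (simp add: nn_integral_hyperbolic_measure)
  qed
  show ?thesis
    using weighted[of 1] weighted[of "-1"] by (simp add: f_divergence_def)
qed

theorem mainTheorem4:
  fixes f :: "real \<Rightarrow> real"
  assumes "convex_on {0<..} f"
    and "f 1 = 0"
  shows "sym_pos_def = (\<Union>t\<in>{0<..}. Theta t) \<and>
    (\<forall>t>0. \<forall>\<theta>\<^sub>1\<in>Theta t. \<forall>\<theta>\<^sub>2\<in>Theta t.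
       f_divergence f (poincare_density \<theta>\<^sub>1) (poincare_density \<theta>\<^sub>2)
       = f_divergence f (poincare_density \<theta>\<^sub>2) (poincare_density \<theta>\<^sub>1))"
proof (intro conjI allI impI ballI)
  show "sym_pos_def = (\<Union>t\<in>{0<..}. Theta t)"
    using sym_pos_def_2(3) by (auto simp: Theta_def)
next
  fix t \<theta>\<^sub>1 \<theta>\<^sub>2 assume *: "0 < t" "\<theta>\<^sub>1 \<in> Theta t" "\<theta>\<^sub>2 \<in> Theta t"
  note [measurable] = borel_measurable_divergence_integrand[OF assms(1)]
  \<comment> \<open>Positive and negative parts are swapped separately, so the two extended real
    differences agree term by term.\<close>
  have "(\<integral>\<^sup>+z. ennreal (divergence_integrand f t (poincare_energy \<theta>\<^sub>1 z) (poincare_energy \<theta>\<^sub>2 z)) \<partial>hyperbolic_measure)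
      = (\<integral>\<^sup>+z. ennreal (divergence_integrand f t (poincare_energy \<theta>\<^sub>2 z) (poincare_energy \<theta>\<^sub>1 z)) \<partial>hyperbolic_measure)"
    by (rule nn_integral_hyperbolic_swap[OF *]) measurable
  moreover have "(\<integral>\<^sup>+z. ennreal (- divergence_integrand f t (poincare_energy \<theta>\<^sub>1 z) (poincare_energy \<theta>\<^sub>2 z)) \<partial>hyperbolic_measure)
      = (\<integral>\<^sup>+z. ennreal (- divergence_integrand f t (poincare_energy \<theta>\<^sub>2 z) (poincare_energy \<theta>\<^sub>1 z)) \<partial>hyperbolic_measure)"
    by (rule nn_integral_hyperbolic_swap[OF *, of "\<lambda>u v. ennreal (- divergence_integrand f t u v)"]) measurable
  ultimately show "f_divergence f (poincare_density \<theta>\<^sub>1) (poincare_density \<theta>\<^sub>2)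
      = f_divergence f (poincare_density \<theta>\<^sub>2) (poincare_density \<theta>\<^sub>1)"
    using * by (simp only: f_divergence_poincare[OF assms(1)])
qed

end
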